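(* Suppose that: (i) $c(x,x')=(x-x')^TA(x)(x-x')$ is lower semicontinuous and there are positive constants $\rho_{\min},\rho_{\max}$ with $\rho_{\min}\le v^TA(x)v\le\rho_{\max}$ for all unit vectors $v$ and $P_0$-almost every $x\in\mathbb{R}^d$; (ii) $\ell:\mathbb{R}\to\mathbb{R}$ is convex, $\kappa:=\inf\{s\ge0:\sup_{u\in\mathbb{R}}(\ell(u)-su^2)<\infty\}$ is finite, and $E_{P_0}\|X\|^4<\infty$. Then the function $f_\delta:B\times\mathbb{R}_+\to\mathbb{R}\cup\{\infty\}$ is proper and convex.
   Context: Let $d\ge1$, $B\subseteq\mathbb{R}^d$ a nonempty convex set, $\delta>0$, $P_0$ a Borel probability measure on $\mathbb{R}^d$, $\ell:\mathbb{R}\to\mathbb{R}$, and $A:\mathbb{R}^d\to\mathbb{S}_d^{++}$ (real symmetric positive definite $d\times d$ matrices). $E_{P_0}$ denotes expectation with $X\sim P_0$, and $\mathbb{R}_+=[0,\infty)$. Define $$F(\gamma,\beta,\lambda;x)=\ell\big(\beta^Tx+\gamma\sqrt\delta\,\beta^TA(x)^{-1}\beta\big)-\lambda\sqrt\delta\,\big(\gamma^2\beta^TA(x)^{-1}\beta-1\big),$$ $\ell_{rob}(\beta,\lambda;x)=\sup_{\gamma\in\mathbb{R}}F(\gamma,\beta,\lambda;x)$ and $f_\delta(\beta,\lambda)=E_{P_0}[\ell_{rob}(\beta,\lambda;X)]$. *)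

theory Defs
  imports "HOL-Probability.Probability"
begin

definition sym_pos_def :: "real^'d^'d \<Rightarrow> bool" where
  "sym_pos_def M \<longleftrightarrow> transpose M = M \<and> (\<forall>v. v \<noteq> 0 \<longrightarrow> 0 < v \<bullet> (M *v v))"

definition lower_semicontinuous :: "('a::topological_space \<Rightarrow> real) \<Rightarrow> bool" where
  "lower_semicontinuous f \<longleftrightarrow> (\<forall>x. ereal (f x) \<le> Liminf (at x) (\<lambda>y. ereal (f y)))"

definition transport_cost :: "(real^'d \<Rightarrow> real^'d^'d) \<Rightarrow> (real^'d) \<times> (real^'d) \<Rightarrow> real" where
  "transport_cost A = (\<lambda>(x, x'). (x - x') \<bullet> (A x *v (x - x')))"

text \<open>The infimum is taken in the extended reals, so it is infinite when no \<open>s\<close> is admissible.\<close>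

definition growth_constant :: "(real \<Rightarrow> real) \<Rightarrow> ereal" where
  "growth_constant l =
     Inf {ereal s | s. 0 \<le> s \<and> (SUP u::real. ereal (l u - s * u\<^sup>2)) < \<infinity>}"

definition dual_objective ::
  "(real \<Rightarrow> real) \<Rightarrow> (real^'d \<Rightarrow> real^'d^'d) \<Rightarrow> real \<Rightarrow> real \<Rightarrow> real^'d \<Rightarrow> real \<Rightarrow> real^'d \<Rightarrow> real" where
  "dual_objective l A \<delta> \<gamma> \<beta> lam x =
     l (\<beta> \<bullet> x + \<gamma> * sqrt \<delta> * (\<beta> \<bullet> (matrix_inv (A x) *v \<beta>)))
       - lam * sqrt \<delta> * (\<gamma>\<^sup>2 * (\<beta> \<bullet> (matrix_inv (A x) *v \<beta>)) - 1)"

definition robust_loss ::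
  "(real \<Rightarrow> real) \<Rightarrow> (real^'d \<Rightarrow> real^'d^'d) \<Rightarrow> real \<Rightarrow> real^'d \<Rightarrow> real \<Rightarrow> real^'d \<Rightarrow> ereal" where
  "robust_loss l A \<delta> \<beta> lam x = (SUP \<gamma>::real. ereal (dual_objective l A \<delta> \<gamma> \<beta> lam x))"

text \<open>
  Expectation of an extended-real-valued function, with values in the extended reals.
  Whenever the function is not measurable or its negative part has infinite integral, the
  value is minus infinity; hence a value other than minus infinity certifies that the
  expectation is well defined. Note that \<open>e2ennreal\<close> maps negative arguments to zero, so the
  two integrals are those of the positive and the negative part.
\<close>

definition ereal_expectation :: "'a measure \<Rightarrow> ('a \<Rightarrow> ereal) \<Rightarrow> ereal" where
  "ereal_expectation M g =
     (if g \<in> borel_measurable M \<and> (\<integral>\<^sup>+ x. e2ennreal (- g x) \<partial>M) < \<infinity>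
      then enn2ereal (\<integral>\<^sup>+ x. e2ennreal (g x) \<partial>M) - enn2ereal (\<integral>\<^sup>+ x. e2ennreal (- g x) \<partial>M)
      else - \<infinity>)"

definition robust_objective ::
  "(real^'d) measure \<Rightarrow> (real \<Rightarrow> real) \<Rightarrow> (real^'d \<Rightarrow> real^'d^'d) \<Rightarrow> real \<Rightarrow> (real^'d) \<times> real \<Rightarrow> ereal" where
  "robust_objective P l A \<delta> = (\<lambda>(\<beta>, lam). ereal_expectation P (robust_loss l A \<delta> \<beta> lam))"

definition proper_on :: "'a set \<Rightarrow> ('a \<Rightarrow> ereal) \<Rightarrow> bool" where
  "proper_on S f \<longleftrightarrow> (\<forall>x\<in>S. f x \<noteq> - \<infinity>) \<and> (\<exists>x\<in>S. f x < \<infinity>)"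

text \<open>
  The extended-real analogue of \<open>convex_on\<close>; since zero times infinity is zero in \<open>ereal\<close>,
  the degenerate weights impose no condition.
\<close>

definition ereal_convex_on :: "'a::real_vector set \<Rightarrow> ('a \<Rightarrow> ereal) \<Rightarrow> bool" where
  "ereal_convex_on S f \<longleftrightarrow> convex S \<and>
     (\<forall>x\<in>S. \<forall>y\<in>S. \<forall>u\<ge>0. \<forall>v\<ge>0. u + v = 1 \<longrightarrow>
        f (u *\<^sub>R x + v *\<^sub>R y) \<le> ereal u * f x + ereal v * f y)"

end

theory Submission
  imports Defs
begin

text \<open>
  With \<open>\<Delta> = \<gamma> \<surd>\<delta> A(x)\<^sup>-\<^sup>1 \<beta>\<close>, and because \<open>t\<^sup>2 / (\<beta>\<^sup>T A(x)\<^sup>-\<^sup>1 \<beta>)\<close> is the least value of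
  \<open>\<Delta>\<^sup>T A(x) \<Delta>\<close> subject to \<open>\<beta>\<^sup>T \<Delta> = t\<close>, the robust loss is the supremum over all vectors \<open>\<Delta>\<close> of
  \<open>\<ell>(\<beta>\<^sup>T (x + \<Delta>)) - \<lambda> (\<Delta>\<^sup>T A(x) \<Delta> / \<surd>\<delta> - \<surd>\<delta>)\<close>. Each of these functions is convex in \<open>\<beta>\<close> and
  affine in \<open>\<lambda>\<close>, so the robust loss is jointly convex for every \<open>x\<close>. Its expectation is never
  minus infinity since \<open>\<gamma> = 0\<close> bounds it below by a function of linear growth, and it is finite
  once \<open>\<lambda>\<close> is so large that the penalty absorbs the quadratic growth of \<open>\<ell>\<close>.
\<close>

section \<open>Expectations with extended real values\<close>

lemma ereal_expectation_eq_integral: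
  assumes "g \<in> borel_measurable M" and "integrable M r" and "AE x in M. g x = ereal (r x)"
  shows "ereal_expectation M g = ereal (integral\<^sup>L M r)"
proof -
  have pos: "(\<integral>\<^sup>+ x. e2ennreal (g x) \<partial>M) = (\<integral>\<^sup>+ x. ennreal (r x) \<partial>M)"
    by (rule nn_integral_cong_AE) (use assms(3) in auto)
  have neg: "(\<integral>\<^sup>+ x. e2ennreal (- g x) \<partial>M) = (\<integral>\<^sup>+ x. ennreal (- r x) \<partial>M)"
    by (rule nn_integral_cong_AE) (use assms(3) in auto)
  obtain a where a: "0 \<le> a" "(\<integral>\<^sup>+ x. ennreal (r x) \<partial>M) = ennreal a"
    using integrableD(2)[OF assms(2)] by (cases "\<integral>\<^sup>+ x. ennreal (r x) \<partial>M") auto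
  obtain b where b: "0 \<le> b" "(\<integral>\<^sup>+ x. ennreal (- r x) \<partial>M) = ennreal b"
    using integrableD(3)[OF assms(2)] by (cases "\<integral>\<^sup>+ x. ennreal (- r x) \<partial>M") auto
  have "integral\<^sup>L M r = a - b"
    using real_lebesgue_integral_def[OF assms(2)] a b by simp
  then show ?thesis
    using assms(1) a b by (simp add: ereal_expectation_def pos neg enn2ereal_ennreal)
qed

text \<open>Regularity is asked of \<open>h\<close> alone: if \<open>g\<close> is not measurable or
  its negative part has infinite integral, the left side is minus infinity by convention. Otherwise
  the positive and negative parts are compared separately.\<close>

lemma ereal_expectation_mono:
  assumes "AE x in M. g x \<le> h x" and "h \<in> borel_measurable M"
    and "(\<integral>\<^sup>+ x. e2ennreal (- h x) \<partial>M) < \<infinity>"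
  shows "ereal_expectation M g \<le> ereal_expectation M h"
proof (cases "g \<in> borel_measurable M \<and> (\<integral>\<^sup>+ x. e2ennreal (- g x) \<partial>M) < \<infinity>")
  case True
  have "(\<integral>\<^sup>+ x. e2ennreal (g x) \<partial>M) \<le> (\<integral>\<^sup>+ x. e2ennreal (h x) \<partial>M)"
    by (rule nn_integral_mono_AE) (use assms(1) in \<open>eventually_elim; simp add: e2ennreal_mono\<close>)
  moreover have "(\<integral>\<^sup>+ x. e2ennreal (- h x) \<partial>M) \<le> (\<integral>\<^sup>+ x. e2ennreal (- g x) \<partial>M)"
    by (rule nn_integral_mono_AE) (use assms(1) in \<open>eventually_elim; simp add: e2ennreal_mono\<close>)
  ultimately show ?thesis
    using True assms by (auto simp: ereal_expectation_def less_eq_ennreal.rep_eq intro: ereal_minus_mono)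
qed (auto simp: ereal_expectation_def)

text \<open>An integrable minorant dominates the negative part. The first conclusion supplies the
  side condition of \<open>ereal_expectation_mono\<close>, the second the lower half of
  properness.\<close>

lemma ereal_expectation_lower_bound:
  assumes "g \<in> borel_measurable M" and "integrable M h" and "AE x in M. ereal (h x) \<le> g x"
  shows "(\<integral>\<^sup>+ x. e2ennreal (- g x) \<partial>M) < \<infinity>" and "ereal_expectation M g \<noteq> - \<infinity>"
proof -
  have "(\<integral>\<^sup>+ x. e2ennreal (- g x) \<partial>M) \<le> (\<integral>\<^sup>+ x. ennreal (- h x) \<partial>M)"
    by (rule nn_integral_mono_AE)
      (use assms(3) in \<open>auto simp flip: e2ennreal_ereal uminus_ereal.simps intro!: e2ennreal_mono\<close>)
  also have "\<dots> < \<infinity>"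
    using integrableD(3)[OF assms(2)] by (simp add: less_top)
  finally show fin: "(\<integral>\<^sup>+ x. e2ennreal (- g x) \<partial>M) < \<infinity>" .
  have "ereal (integral\<^sup>L M h) = ereal_expectation M (\<lambda>x. ereal (h x))"
    using assms(2) by (intro ereal_expectation_eq_integral[symmetric]) auto
  also have "\<dots> \<le> ereal_expectation M g"
    using assms fin by (intro ereal_expectation_mono) auto
  finally show "ereal_expectation M g \<noteq> - \<infinity>"
    by auto
qed

text \<open>Both parts have finite integral, so almost everywhere neither \<infinity> nor its
  negative is attained, and \<open>real_of_ereal\<close> gives an integrable representative.\<close>

lemma ereal_expectation_finiteE:
  assumes "\<bar>ereal_expectation M g\<bar> \<noteq> \<infinity>"
  obtains r where "integrable M r" and "AE x in M. g x = ereal (r x)"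
proof -
  have [measurable]: "g \<in> borel_measurable M" and neg: "(\<integral>\<^sup>+ x. e2ennreal (- g x) \<partial>M) < \<infinity>"
    using assms by (auto simp: ereal_expectation_def split: if_splits)
  have pos: "(\<integral>\<^sup>+ x. e2ennreal (g x) \<partial>M) \<noteq> \<infinity>"
    using assms neg by (auto simp: ereal_expectation_def)
  have "AE x in M. e2ennreal (g x) \<noteq> \<infinity>"
    by (rule nn_integral_PInf_AE[OF _ pos]) measurable
  moreover have "AE x in M. e2ennreal (- g x) \<noteq> \<infinity>"
    by (rule nn_integral_PInf_AE) (use neg in auto)
  ultimately have eq: "AE x in M. g x = ereal (real_of_ereal (g x))"
  proof eventually_elim
    case (elim x)
    then show ?case by (cases "g x") auto
  qed
  have p: "(\<integral>\<^sup>+ x. ennreal (real_of_ereal (g x)) \<partial>M) = (\<integral>\<^sup>+ x. e2ennreal (g x) \<partial>M)"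
    by (rule nn_integral_cong_AE) (use eq in \<open>eventually_elim; metis e2ennreal_ereal\<close>)
  have n: "(\<integral>\<^sup>+ x. ennreal (- real_of_ereal (g x)) \<partial>M) = (\<integral>\<^sup>+ x. e2ennreal (- g x) \<partial>M)"
    by (rule nn_integral_cong_AE)
      (use eq in \<open>eventually_elim; metis e2ennreal_ereal uminus_ereal.simps(1)\<close>)
  have "integrable M (\<lambda>x. real_of_ereal (g x))"
    unfolding real_integrable_def using p n pos neg by auto
  then show ?thesis
    using eq that by blast
qed

text \<open>With positive weights and no value minus infinity, one infinite expectation makes the
  right side infinite. Otherwise real representatives reduce the claim to linearity of the Lebesgue
  integral.\<close>

lemma ereal_expectation_convex_combination:
  assumes le: "AE x in M. g x \<le> ereal u * g\<^sub>1 x + ereal v * g\<^sub>2 x"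
    and "ereal_expectation M g\<^sub>1 \<noteq> - \<infinity>" and "ereal_expectation M g\<^sub>2 \<noteq> - \<infinity>"
    and uv: "0 < u" "0 < v"
  shows "ereal_expectation M g \<le> ereal u * ereal_expectation M g\<^sub>1 + ereal v * ereal_expectation M g\<^sub>2"
proof (cases "ereal_expectation M g\<^sub>1 = \<infinity> \<or> ereal_expectation M g\<^sub>2 = \<infinity>")
  case True
  then show ?thesis
    using assms by (cases "ereal_expectation M g\<^sub>1"; cases "ereal_expectation M g\<^sub>2") auto
next
  case False
  then have fin: "\<bar>ereal_expectation M g\<^sub>1\<bar> \<noteq> \<infinity>" "\<bar>ereal_expectation M g\<^sub>2\<bar> \<noteq> \<infinity>"
    using assms by auto
  obtain r where r: "integrable M r" "AE x in M. g\<^sub>1 x = ereal (r x)"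
    by (rule ereal_expectation_finiteE[OF fin(1)])
  obtain s where s: "integrable M s" "AE x in M. g\<^sub>2 x = ereal (s x)"
    by (rule ereal_expectation_finiteE[OF fin(2)])
  have meas: "g\<^sub>1 \<in> borel_measurable M" "g\<^sub>2 \<in> borel_measurable M"
    using fin by (auto simp: ereal_expectation_def split: if_splits)
  have int: "integrable M (\<lambda>x. u * r x + v * s x)"
    using r(1) s(1) by auto
  have "ereal_expectation M g \<le> ereal_expectation M (\<lambda>x. ereal (u * r x + v * s x))"
  proof (rule ereal_expectation_mono)
    show "AE x in M. g x \<le> ereal (u * r x + v * s x)"
      using le r(2) s(2) by eventually_elim simp
    show "(\<lambda>x. ereal (u * r x + v * s x)) \<in> borel_measurable M"
      using int by auto
    then show "(\<integral>\<^sup>+ x. e2ennreal (- ereal (u * r x + v * s x)) \<partial>M) < \<infinity>"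
      by (rule ereal_expectation_lower_bound(1)[OF _ int]) auto
  qed
  also have "\<dots> = ereal (u * integral\<^sup>L M r + v * integral\<^sup>L M s)"
    using int r(1) s(1) by (subst ereal_expectation_eq_integral[OF _ int]) auto
  also have "\<dots> = ereal u * ereal_expectation M g\<^sub>1 + ereal v * ereal_expectation M g\<^sub>2"
    using ereal_expectation_eq_integral[OF meas(1) r] ereal_expectation_eq_integral[OF meas(2) s]
    by simp
  finally show ?thesis .
qed

section \<open>Suprema over uncountable families\<close>

text \<open>By continuity the indices \<open>a\<close> with \<open>y < f a x\<close> form an open
  set, which meets a countable dense set as soon as it is nonempty. Hence a countable union
  describes each superlevel set of the supremum.\<close>

lemma borel_measurable_SUP_continuous:
  fixes f :: "'a::second_countable_topology \<Rightarrow> 'b \<Rightarrow> ereal"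
  assumes meas: "\<And>a. f a \<in> borel_measurable M"
    and cont: "\<And>x. continuous_on UNIV (\<lambda>a. f a x)"
  shows "(\<lambda>x. SUP a. f a x) \<in> borel_measurable M"
proof (rule borel_measurableI_greater)
  fix y :: ereal
  obtain D :: "'a set" where D: "countable D" "\<And>X. open X \<Longrightarrow> X \<noteq> {} \<Longrightarrow> \<exists>d\<in>D. d \<in> X"
    using countable_dense_setE by blast
  have "\<exists>a\<in>D. y < f a x" if "y < f b x" for b x
  proof -
    have "open {a. y < f a x}"
      by (intro open_Collect_less continuous_intros cont)
    then show ?thesis
      using D(2)[of "{a. y < f a x}"] that by auto
  qed
  then have "{x \<in> space M. y < (SUP a. f a x)} = (\<Union>a\<in>D. {x \<in> space M. y < f a x})"
    by (auto simp: less_SUP_iff)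
  also have "\<dots> \<in> sets M"
    using D(1) meas by (intro sets.countable_UN') (auto simp: borel_measurable_iff_greater)
  finally show "{x \<in> space M. y < (SUP a. f a x)} \<in> sets M" .
qed

section \<open>Positive definite forms and their inverses\<close>

lemma sym_pos_def_dot_commute:
  "sym_pos_def M \<Longrightarrow> v \<bullet> (M *v w) = w \<bullet> (M *v v)"
  by (metis dot_lmul_matrix inner_commute sym_pos_def_def transpose_matrix_vector)

lemma sym_pos_def_nonneg:
  "sym_pos_def M \<Longrightarrow> 0 \<le> v \<bullet> (M *v v)"
  by (cases "v = 0") (auto simp: sym_pos_def_def less_imp_le)

lemma sym_pos_def_matrix_inv:
  assumes "sym_pos_def M"
  shows "M *v (matrix_inv M *v b) = b"
proof -
  have "inj ((*v) M)"
  proof (rule injI)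
    fix v w
    assume "M *v v = M *v w"
    then have "M *v (v - w) = 0"
      by (simp add: matrix_vector_mult_diff_distrib)
    then show "v = w"
      using assms by (metis eq_iff_diff_eq_0 inner_zero_right less_irrefl sym_pos_def_def)
  qed
  then have "invertible M"
    by (metis invertible_left_inverse matrix_left_invertible_injective)
  then have "M ** matrix_inv M = mat 1"
    unfolding invertible_def matrix_inv_def by (rule someI2_ex) simp
  then show ?thesis
    by (simp add: matrix_vector_mul_assoc)
qed

lemma sym_pos_def_matrix_inv_nonneg:
  assumes "sym_pos_def M"
  shows "0 \<le> b \<bullet> (matrix_inv M *v b)"
  using sym_pos_def_nonneg[OF assms, of "matrix_inv M *v b"]
  by (simp add: sym_pos_def_matrix_inv[OF assms] inner_commute)

text \<open>This is Cauchy-Schwarz for the inner product induced by \<open>M\<close>, applied to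
  \<open>v\<close> and \<open>matrix_inv M *v b\<close>.\<close>

lemma sym_pos_def_cauchy_schwarz:
  assumes "sym_pos_def M"
  shows "(b \<bullet> v)\<^sup>2 \<le> (b \<bullet> (matrix_inv M *v b)) * (v \<bullet> (M *v v))"
proof (cases "b = 0")
  case False
  define w where "w = matrix_inv M *v b"
  have Mw: "M *v w = b"
    using sym_pos_def_matrix_inv[OF assms] by (simp add: w_def)
  have "w \<noteq> 0"
    using Mw False by auto
  then have q: "0 < b \<bullet> w"
    using assms Mw by (metis inner_commute sym_pos_def_def)
  define q where "q = b \<bullet> w"
  define t where "t = b \<bullet> v"
  \<comment> \<open>The vector is \<open>q\<close> times the component of \<open>v\<close> that is
    \<open>M\<close>-orthogonal to \<open>w\<close>; the scaling avoids a division.\<close>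
  have "0 \<le> (q *\<^sub>R v - t *\<^sub>R w) \<bullet> (M *v (q *\<^sub>R v - t *\<^sub>R w))"
    by (rule sym_pos_def_nonneg[OF assms])
  also have "\<dots> = q * (q * (v \<bullet> (M *v v)) - t\<^sup>2)"
    using sym_pos_def_dot_commute[OF assms, of w v]
    by (simp add: matrix_vector_mult_diff_distrib matrix_vector_mult_scaleR inner_diff_left
        inner_diff_right Mw q_def t_def inner_commute algebra_simps power2_eq_square)
  finally show ?thesis
    using q by (simp add: zero_le_mult_iff q_def t_def w_def)
qed simp

text \<open>Completing the square: the gap at \<open>v\<close> is the \<open>M\<close>-form of
  \<open>w - v\<close>, which vanishes at \<open>w = matrix_inv M *v b\<close>. The formula makes
  the inverse form measurable in \<open>x\<close> without handling matrix inversion as a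
  function.\<close>

lemma sym_pos_def_matrix_inv_SUP:
  assumes "sym_pos_def M"
  shows "ereal (b \<bullet> (matrix_inv M *v b)) = (SUP v. ereal (2 * (b \<bullet> v) - v \<bullet> (M *v v)))"
proof (rule antisym)
  define w where "w = matrix_inv M *v b"
  have Mw: "M *v w = b"
    using sym_pos_def_matrix_inv[OF assms] by (simp add: w_def)
  show "ereal (b \<bullet> w) \<le> (SUP v. ereal (2 * (b \<bullet> v) - v \<bullet> (M *v v)))"
    by (rule SUP_upper2[of w]) (auto simp: Mw inner_commute)
  show "(SUP v. ereal (2 * (b \<bullet> v) - v \<bullet> (M *v v))) \<le> ereal (b \<bullet> w)"
  proof (rule SUP_least)
    fix v
    have "0 \<le> (w - v) \<bullet> (M *v (w - v))"
      by (rule sym_pos_def_nonneg[OF assms])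
    also have "\<dots> = b \<bullet> w - 2 * (b \<bullet> v) + v \<bullet> (M *v v)"
      using sym_pos_def_dot_commute[OF assms, of w v]
      by (simp add: matrix_vector_mult_diff_distrib inner_diff_left inner_diff_right Mw inner_commute)
    finally show "ereal (2 * (b \<bullet> v) - v \<bullet> (M *v v)) \<le> ereal (b \<bullet> w)"
      by simp
  qed
qed

text \<open>For \<open>w = matrix_inv M *v b\<close>, coercivity gives
  \<open>\<rho> * (norm w)\<^sup>2 \<le> b \<bullet> w\<close>, and Cauchy-Schwarz bounds
  \<open>b \<bullet> w\<close> in turn, which eliminates \<open>norm w\<close>.\<close>

lemma matrix_inv_form_le:
  assumes spd: "sym_pos_def M" and "0 < \<rho>"
    and lower: "\<And>v. norm v = 1 \<Longrightarrow> \<rho> \<le> v \<bullet> (M *v v)"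
  shows "b \<bullet> (matrix_inv M *v b) \<le> (norm b)\<^sup>2 / \<rho>"
proof -
  define w where "w = matrix_inv M *v b"
  have Mw: "M *v w = b"
    using sym_pos_def_matrix_inv[OF spd] by (simp add: w_def)
  have nonneg: "0 \<le> b \<bullet> w"
    using sym_pos_def_matrix_inv_nonneg[OF spd] by (simp add: w_def)
  have "\<rho> * (norm w)\<^sup>2 \<le> b \<bullet> w"
  proof (cases "w = 0")
    case False
    then have "\<rho> \<le> (w /\<^sub>R norm w) \<bullet> (M *v (w /\<^sub>R norm w))"
      by (intro lower) simp
    also have "\<dots> = (b \<bullet> w) / (norm w)\<^sup>2"
      by (simp add: matrix_vector_mult_scaleR Mw inner_commute power2_eq_square field_simps)
    finally show ?thesis
      using False by (simp add: field_simps)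
  qed simp
  moreover have "(b \<bullet> w)\<^sup>2 \<le> (norm b)\<^sup>2 * (norm w)\<^sup>2"
    using Cauchy_Schwarz_ineq[of b w] by (simp add: power2_norm_eq_inner)
  ultimately have "\<rho> * (b \<bullet> w)\<^sup>2 \<le> (norm b)\<^sup>2 * (b \<bullet> w)"
    using \<open>0 < \<rho>\<close> by (smt (verit) mult.left_commute mult_left_mono zero_le_power2)
  then have "(b \<bullet> w) * (\<rho> * (b \<bullet> w)) \<le> (b \<bullet> w) * (norm b)\<^sup>2"
    by (simp add: power2_eq_square mult_ac)
  then have "\<rho> * (b \<bullet> w) \<le> (norm b)\<^sup>2"
    using nonneg by (cases "b \<bullet> w = 0") auto
  then show "b \<bullet> w \<le> (norm b)\<^sup>2 / \<rho>"
    using \<open>0 < \<rho>\<close> by (simp add: field_simps)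
qed

section \<open>Measurability of the robust loss\<close>

text \<open>On the slice \<open>x' = x - v\<close> the transport cost is the form at
  \<open>v\<close>, so lower semicontinuity makes its superlevel sets open.\<close>

lemma borel_measurable_quadratic_form:
  fixes A :: "real^'d \<Rightarrow> real^'d^'d"
  assumes "lower_semicontinuous (transport_cost A)"
  shows "(\<lambda>x. v \<bullet> (A x *v v)) \<in> borel_measurable borel"
proof (rule borel_measurableI_greater)
  fix a
  have "open {x. a < v \<bullet> (A x *v v)}"
  proof (subst open_subopen, safe)
    fix x assume a: "a < v \<bullet> (A x *v v)"
    have "ereal (transport_cost A (x, x - v)) \<le> Liminf (at (x, x - v)) (\<lambda>y. ereal (transport_cost A y))"
      using assms unfolding lower_semicontinuous_def by blast
    then have "\<forall>\<^sub>F y in at (x, x - v). ereal a < ereal (transport_cost A y)"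
      unfolding le_Liminf_iff by (rule allE[where x = "ereal a"]) (use a in \<open>simp add: transport_cost_def\<close>)
    \<comment> \<open>The slice map is injective, so punctured neighbourhoods go to punctured
      ones.\<close>
    moreover have "filterlim (\<lambda>y. (y, y - v)) (at (x, x - v)) (at x)"
      by (auto simp: filterlim_at eventually_at_filter intro!: tendsto_eq_intros)
    ultimately have "\<forall>\<^sub>F y in at x. ereal a < ereal (transport_cost A (y, y - v))"
      by (rule eventually_compose_filterlim)
    \<comment> \<open>The inequality \<open>a\<close> at \<open>x\<close> itself fills the
      puncture.\<close>
    then have "\<forall>\<^sub>F y in nhds x. a < v \<bullet> (A y *v v)"
      using a by (auto simp: eventually_at_filter transport_cost_def elim: eventually_mono)
    then show "\<exists>T. open T \<and> x \<in> T \<and> T \<subseteq> {x. a < v \<bullet> (A x *v v)}"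
      by (auto simp: eventually_nhds)
  qed
  then show "{x \<in> space borel. a < v \<bullet> (A x *v v)} \<in> sets borel"
    by simp
qed

lemma borel_measurable_matrix_inv_form:
  fixes A :: "real^'d \<Rightarrow> real^'d^'d"
  assumes "lower_semicontinuous (transport_cost A)" and "\<And>x. sym_pos_def (A x)"
  shows "(\<lambda>x. b \<bullet> (matrix_inv (A x) *v b)) \<in> borel_measurable borel"
proof -
  have "(\<lambda>x. SUP v. ereal (2 * (b \<bullet> v) - v \<bullet> (A x *v v))) \<in> borel_measurable borel"
  proof (rule borel_measurable_SUP_continuous)
    show "(\<lambda>x. ereal (2 * (b \<bullet> v) - v \<bullet> (A x *v v))) \<in> borel_measurable borel" for v
      using borel_measurable_quadratic_form[OF assms(1)] by measurable
    show "continuous_on UNIV (\<lambda>v. ereal (2 * (b \<bullet> v) - v \<bullet> (A x *v v)))" for x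
      by (intro continuous_intros matrix_vector_mult_linear_continuous_on)
  qed
  then have "(\<lambda>x. ereal (b \<bullet> (matrix_inv (A x) *v b))) \<in> borel_measurable borel"
    by (simp add: sym_pos_def_matrix_inv_SUP[OF assms(2)])
  then show ?thesis
    by simp
qed

text \<open>A finite convex function on the line is continuous, so the objective is continuous in
  \<gamma> and measurable in \<open>x\<close>.\<close>

lemma borel_measurable_robust_loss:
  fixes A :: "real^'d \<Rightarrow> real^'d^'d"
  assumes "lower_semicontinuous (transport_cost A)" and "\<And>x. sym_pos_def (A x)"
    and "convex_on UNIV l"
  shows "robust_loss l A \<delta> \<beta> lam \<in> borel_measurable borel"
proof -
  have cont: "continuous_on UNIV l"
    using assms(3) by (intro convex_on_continuous) auto
  have [measurable]: "l \<in> borel_measurable borel"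
    using cont by (rule borel_measurable_continuous_onI)
  note [measurable] = borel_measurable_matrix_inv_form[OF assms(1,2)]
  have "(\<lambda>x. SUP \<gamma>. ereal (dual_objective l A \<delta> \<gamma> \<beta> lam x)) \<in> borel_measurable borel"
  proof (rule borel_measurable_SUP_continuous)
    show "(\<lambda>x. ereal (dual_objective l A \<delta> \<gamma> \<beta> lam x)) \<in> borel_measurable borel" for \<gamma>
      unfolding dual_objective_def by measurable
    show "continuous_on UNIV (\<lambda>\<gamma>. ereal (dual_objective l A \<delta> \<gamma> \<beta> lam x))" for x
      unfolding dual_objective_def
      by (intro continuous_intros continuous_on_compose2[OF cont]) auto
  qed
  then show ?thesis
    unfolding robust_loss_def .
qed

section \<open>Joint convexity of the robust loss\<close>

text \<open>One half of the reformulation by displacements: choose \<gamma> to give the same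
  argument of \<open>l\<close> as \<open>v\<close>. By Cauchy-Schwarz its penalty is no larger, and
  \<open>0 \<le> lam\<close> preserves that comparison.\<close>

lemma displaced_loss_le_robust_loss:
  assumes spd: "sym_pos_def (A x)" and "0 < \<delta>" and "0 \<le> lam"
  shows "ereal (l (\<beta> \<bullet> x + \<beta> \<bullet> v) - lam * (v \<bullet> (A x *v v) / sqrt \<delta> - sqrt \<delta>))
    \<le> robust_loss l A \<delta> \<beta> lam x"
proof -
  define q where "q = \<beta> \<bullet> (matrix_inv (A x) *v \<beta>)"
  define t where "t = \<beta> \<bullet> v"
  define D where "D = v \<bullet> (A x *v v)"
  \<comment> \<open>If \<open>q = 0\<close> then \<open>t = 0\<close> by \<open>le\<close> below, so the junk value \<open>\<gamma> = 0\<close> still fits.\<close>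
  define \<gamma> where "\<gamma> = t / (sqrt \<delta> * q)"
  have le: "t\<^sup>2 \<le> q * D"
    using sym_pos_def_cauchy_schwarz[OF spd] by (simp add: t_def q_def D_def)
  have D: "0 \<le> D"
    using sym_pos_def_nonneg[OF spd] by (simp add: D_def)
  have q: "0 \<le> q"
    using sym_pos_def_matrix_inv_nonneg[OF spd] by (simp add: q_def)
  have shift: "\<gamma> * sqrt \<delta> * q = t"
    using le \<open>0 < \<delta>\<close> by (cases "q = 0") (auto simp: \<gamma>_def)
  have "sqrt \<delta> * (\<gamma>\<^sup>2 * q) \<le> D / sqrt \<delta>"
  proof (cases "q = 0")
    case False
    have "sqrt \<delta> * (sqrt \<delta> * (\<gamma>\<^sup>2 * q)) * q = (\<gamma> * sqrt \<delta> * q)\<^sup>2"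
      by (simp add: power2_eq_square mult_ac)
    also have "\<dots> \<le> D * q"
      unfolding shift using le by (simp add: mult.commute)
    finally have "sqrt \<delta> * (sqrt \<delta> * (\<gamma>\<^sup>2 * q)) \<le> D"
      using False q by simp
    then show ?thesis
      using \<open>0 < \<delta>\<close> by (simp add: field_simps)
  qed (use D \<open>0 < \<delta>\<close> in simp)
  then have "lam * (sqrt \<delta> * (\<gamma>\<^sup>2 * q) - sqrt \<delta>) \<le> lam * (D / sqrt \<delta> - sqrt \<delta>)"
    using \<open>0 \<le> lam\<close> by (intro mult_left_mono) auto
  moreover have "dual_objective l A \<delta> \<gamma> \<beta> lam x
      = l (\<beta> \<bullet> x + t) - lam * (sqrt \<delta> * (\<gamma>\<^sup>2 * q) - sqrt \<delta>)"
    unfolding dual_objective_def q_def[symmetric] shift by (simp add: algebra_simps)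
  ultimately show ?thesis
    unfolding robust_loss_def by (intro SUP_upper2[of \<gamma>]) (auto simp: t_def D_def)
qed

text \<open>Each \<gamma> for the combined parameters yields a displacement \<open>d\<close>. The
  same \<open>d\<close> is then used at both endpoints, where
  \<open>displaced_loss_le_robust_loss\<close> returns to the robust loss. For fixed
  \<open>d\<close>, \<open>G\<close> is convex in the pair \<open>(b, m)\<close>.\<close>

lemma robust_loss_convex:
  assumes spd: "sym_pos_def (A x)" and \<delta>: "0 < \<delta>" and cvx: "convex_on UNIV l"
    and lam: "0 \<le> lam\<^sub>1" "0 \<le> lam\<^sub>2" and uv: "0 \<le> u" "0 \<le> v" "u + v = 1"
  shows "robust_loss l A \<delta> (u *\<^sub>R \<beta>\<^sub>1 + v *\<^sub>R \<beta>\<^sub>2) (u * lam\<^sub>1 + v * lam\<^sub>2) x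
    \<le> ereal u * robust_loss l A \<delta> \<beta>\<^sub>1 lam\<^sub>1 x + ereal v * robust_loss l A \<delta> \<beta>\<^sub>2 lam\<^sub>2 x"
proof -
  define \<beta> where "\<beta> = u *\<^sub>R \<beta>\<^sub>1 + v *\<^sub>R \<beta>\<^sub>2"
  define lam where "lam = u * lam\<^sub>1 + v * lam\<^sub>2"
  define G where "G b m d = l (b \<bullet> x + b \<bullet> d) - m * (d \<bullet> (A x *v d) / sqrt \<delta> - sqrt \<delta>)" for b m d
  have "robust_loss l A \<delta> \<beta> lam x
    \<le> ereal u * robust_loss l A \<delta> \<beta>\<^sub>1 lam\<^sub>1 x + ereal v * robust_loss l A \<delta> \<beta>\<^sub>2 lam\<^sub>2 x"
    unfolding robust_loss_def[of l A \<delta> \<beta> lam]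
  proof (rule SUP_least)
    fix \<gamma>
    define q where "q = \<beta> \<bullet> (matrix_inv (A x) *v \<beta>)"
    \<comment> \<open>This direction gives equality in Cauchy-Schwarz, so \<open>G\<close>
      reproduces the dual objective exactly.\<close>
    define d where "d = (\<gamma> * sqrt \<delta>) *\<^sub>R (matrix_inv (A x) *v \<beta>)"
    have "d \<bullet> (A x *v d) / sqrt \<delta> = sqrt \<delta> * (\<gamma>\<^sup>2 * q)"
      using \<delta> by (simp add: d_def q_def matrix_vector_mult_scaleR sym_pos_def_matrix_inv[OF spd]
          inner_commute power2_eq_square)
    moreover have "\<beta> \<bullet> d = \<gamma> * sqrt \<delta> * q"
      by (simp add: d_def q_def)
    ultimately have "dual_objective l A \<delta> \<gamma> \<beta> lam x = G \<beta> lam d"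
      by (simp add: G_def dual_objective_def algebra_simps flip: q_def)
    also have "\<dots> \<le> u * G \<beta>\<^sub>1 lam\<^sub>1 d + v * G \<beta>\<^sub>2 lam\<^sub>2 d"
    proof -
      have "l (\<beta> \<bullet> x + \<beta> \<bullet> d) = l (u * (\<beta>\<^sub>1 \<bullet> x + \<beta>\<^sub>1 \<bullet> d) + v * (\<beta>\<^sub>2 \<bullet> x + \<beta>\<^sub>2 \<bullet> d))"
        by (simp add: \<beta>_def inner_add_left algebra_simps)
      also have "\<dots> \<le> u * l (\<beta>\<^sub>1 \<bullet> x + \<beta>\<^sub>1 \<bullet> d) + v * l (\<beta>\<^sub>2 \<bullet> x + \<beta>\<^sub>2 \<bullet> d)"
        using cvx uv by (simp add: convex_on_def)
      finally show ?thesis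
        by (simp add: G_def lam_def algebra_simps add_divide_distrib)
    qed
    finally have "ereal (dual_objective l A \<delta> \<gamma> \<beta> lam x)
        \<le> ereal u * ereal (G \<beta>\<^sub>1 lam\<^sub>1 d) + ereal v * ereal (G \<beta>\<^sub>2 lam\<^sub>2 d)"
      by simp
    also have "\<dots> \<le> ereal u * robust_loss l A \<delta> \<beta>\<^sub>1 lam\<^sub>1 x + ereal v * robust_loss l A \<delta> \<beta>\<^sub>2 lam\<^sub>2 x"
      unfolding G_def using uv spd \<delta> lam
      by (intro add_mono ereal_mult_left_mono displaced_loss_le_robust_loss) auto
    finally show "ereal (dual_objective l A \<delta> \<gamma> \<beta> lam x)
      \<le> ereal u * robust_loss l A \<delta> \<beta>\<^sub>1 lam\<^sub>1 x + ereal v * robust_loss l A \<delta> \<beta>\<^sub>2 lam\<^sub>2 x" .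
  qed
  then show ?thesis
    by (simp add: \<beta>_def lam_def)
qed

section \<open>Growth bounds and moments\<close>

text \<open>The slope is a subgradient of \<open>l\<close> at 0.\<close>

lemma convex_on_real_affine_minorant:
  fixes l :: "real \<Rightarrow> real"
  assumes "convex_on UNIV l"
  obtains g where "\<And>u. l 0 + g * u \<le> l u"
  using convex_le_Inf_differential[OF assms, of 0] by force

text \<open>The infimum of the empty set is \<infinity>, so finiteness provides an admissible
  \<open>s\<close>; \<open>C\<close> is any real above the corresponding supremum.\<close>

lemma growth_constant_quadratic_bound:
  assumes "\<bar>growth_constant l\<bar> \<noteq> \<infinity>"
  obtains s C where "0 \<le> s" and "\<And>u. l u \<le> C + s * u\<^sup>2"
proof -
  have "{ereal s | s. 0 \<le> s \<and> (SUP u::real. ereal (l u - s * u\<^sup>2)) < \<infinity>} \<noteq> {}"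
    using assms unfolding growth_constant_def by (metis Inf_empty abs_ereal.simps(3) top_ereal_def)
  then obtain s where s: "0 \<le> s" "(SUP u::real. ereal (l u - s * u\<^sup>2)) < \<infinity>"
    by auto
  obtain C where C: "(SUP u::real. ereal (l u - s * u\<^sup>2)) < ereal C"
    using s(2) ereal_dense2 by blast
  have "l u \<le> C + s * u\<^sup>2" for u
  proof -
    have "ereal (l u - s * u\<^sup>2) \<le> (SUP u::real. ereal (l u - s * u\<^sup>2))"
      by (rule SUP_upper) simp
    with C have "ereal (l u - s * u\<^sup>2) < ereal C"
      by (rule le_less_trans[rotated])
    then show ?thesis by simp
  qed
  with s(1) show ?thesis
    using that by blast
qed

text \<open>The condition on \<open>lam\<close> makes the coefficient of \<open>\<gamma>\<^sup>2\<close> nonpositive after splitting the square.\<close>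

lemma robust_loss_upper_bound:
  assumes spd: "sym_pos_def (A x)" and "0 < \<delta>" and "0 \<le> s"
    and growth: "\<And>u. l u \<le> C + s * u\<^sup>2"
    and lam: "2 * s * sqrt \<delta> * (\<beta> \<bullet> (matrix_inv (A x) *v \<beta>)) \<le> lam"
  shows "robust_loss l A \<delta> \<beta> lam x \<le> ereal (C + 2 * s * (\<beta> \<bullet> x)\<^sup>2 + lam * sqrt \<delta>)"
  unfolding robust_loss_def
proof (rule SUP_least)
  fix \<gamma>
  define q where "q = \<beta> \<bullet> (matrix_inv (A x) *v \<beta>)"
  define y where "y = \<beta> \<bullet> x"
  have q: "0 \<le> q"
    using sym_pos_def_matrix_inv_nonneg[OF spd] by (simp add: q_def)
  have "(y + \<gamma> * sqrt \<delta> * q)\<^sup>2 \<le> 2 * y\<^sup>2 + 2 * (\<gamma> * sqrt \<delta> * q)\<^sup>2"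
    using zero_le_power2[of "y - \<gamma> * sqrt \<delta> * q"] by (simp add: power2_eq_square algebra_simps)
  then have "s * (y + \<gamma> * sqrt \<delta> * q)\<^sup>2 \<le> s * (2 * y\<^sup>2 + 2 * (\<gamma> * sqrt \<delta> * q)\<^sup>2)"
    using \<open>0 \<le> s\<close> by (rule mult_left_mono)
  \<comment> \<open>The left side is the \<gamma>-dependent part of the quadratic growth, the right
    side the penalty that absorbs it.\<close>
  moreover have "(2 * s * sqrt \<delta> * q) * (sqrt \<delta> * \<gamma>\<^sup>2 * q) \<le> lam * (sqrt \<delta> * \<gamma>\<^sup>2 * q)"
    using lam q \<open>0 < \<delta>\<close> by (intro mult_right_mono) (auto simp: q_def)
  moreover have "(2 * s * sqrt \<delta> * q) * (sqrt \<delta> * \<gamma>\<^sup>2 * q) = s * (2 * (\<gamma> * sqrt \<delta> * q)\<^sup>2)"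
    by (simp only: power2_eq_square mult_ac)
  ultimately have "s * (y + \<gamma> * sqrt \<delta> * q)\<^sup>2 \<le> 2 * s * y\<^sup>2 + lam * (sqrt \<delta> * \<gamma>\<^sup>2 * q)"
    by (simp only: distrib_left)
  with growth[of "y + \<gamma> * sqrt \<delta> * q"]
  have "l (y + \<gamma> * sqrt \<delta> * q) - lam * sqrt \<delta> * (\<gamma>\<^sup>2 * q - 1) \<le> C + 2 * s * y\<^sup>2 + lam * sqrt \<delta>"
    by (simp add: algebra_simps)
  then show "ereal (dual_objective l A \<delta> \<gamma> \<beta> lam x) \<le> ereal (C + 2 * s * (\<beta> \<bullet> x)\<^sup>2 + lam * sqrt \<delta>)"
    by (simp add: dual_objective_def q_def y_def)
qed

text \<open>The first moment serves the affine lower bound on the loss, the second its quadratic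
  upper bound.\<close>

lemma integrable_inner_moments:
  fixes M :: "(real^'d) measure"
  assumes "prob_space M" and sets: "sets M = sets borel" and "integrable M (\<lambda>x. norm x ^ 4)"
  shows "integrable M (\<lambda>x. b \<bullet> x)" and "integrable M (\<lambda>x. (b \<bullet> x)\<^sup>2)"
proof -
  interpret prob_space M
    by fact
  have [measurable_cong]: "sets M = sets borel"
    by (rule sets)
  \<comment> \<open>This follows by expanding the square of
    \<open>(norm x)\<^sup>2 - 1\<close>.\<close>
  have sq: "(norm x)\<^sup>2 \<le> 1 + norm x ^ 4" for x :: "real^'d"
    using zero_le_power2[of "(norm x)\<^sup>2 - 1"] zero_le_power[of "norm x" 4]
    by (simp add: power2_diff flip: power_mult) (smt (verit) zero_le_power2)
  have le: "(b \<bullet> x)\<^sup>2 \<le> (norm b)\<^sup>2 * (1 + norm x ^ 4)" for x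
    using Cauchy_Schwarz_ineq[of b x] mult_left_mono[OF sq[of x], of "(norm b)\<^sup>2"]
    by (simp add: power2_norm_eq_inner)
  have "integrable M (\<lambda>x. (norm b)\<^sup>2 * (1 + norm x ^ 4))"
    using assms(3) by auto
  then show square: "integrable M (\<lambda>x. (b \<bullet> x)\<^sup>2)"
    by (rule Bochner_Integration.integrable_bound)
      (auto intro!: AE_I2 order_trans[OF le] simp: abs_mult)
  show "integrable M (\<lambda>x. b \<bullet> x)"
    by (rule square_integrable_imp_integrable[OF _ square]) auto
qed

section \<open>Properness and convexity of the expected robust loss\<close>

theorem theorem2:
  fixes B :: "(real^'d) set"
    and \<delta> :: real
    and P\<^sub>0 :: "(real^'d) measure"
    and l :: "real \<Rightarrow> real"
    and A :: "real^'d \<Rightarrow> real^'d^'d"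
    and \<rho>\<^sub>m\<^sub>i\<^sub>n \<rho>\<^sub>m\<^sub>a\<^sub>x :: real
  assumes "B \<noteq> {}" and "convex B"
    and "0 < \<delta>"
    and "prob_space P\<^sub>0" and "sets P\<^sub>0 = sets borel"
    and "\<And>x. sym_pos_def (A x)"
    and "lower_semicontinuous (transport_cost A)"
    and "0 < \<rho>\<^sub>m\<^sub>i\<^sub>n" and "0 < \<rho>\<^sub>m\<^sub>a\<^sub>x"
    and "AE x in P\<^sub>0. \<forall>v. norm v = 1 \<longrightarrow>
           \<rho>\<^sub>m\<^sub>i\<^sub>n \<le> v \<bullet> (A x *v v) \<and> v \<bullet> (A x *v v) \<le> \<rho>\<^sub>m\<^sub>a\<^sub>x"
    and "convex_on UNIV l"
    and "\<bar>growth_constant l\<bar> \<noteq> \<infinity>"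
    and "integrable P\<^sub>0 (\<lambda>x. norm x ^ 4)"
  shows "proper_on (B \<times> {0..}) (robust_objective P\<^sub>0 l A \<delta>)
       \<and> ereal_convex_on (B \<times> {0..}) (robust_objective P\<^sub>0 l A \<delta>)"
proof -
  interpret prob_space P\<^sub>0
    by fact
  have [measurable_cong]: "sets P\<^sub>0 = sets borel"
    by fact
  note spd = \<open>\<And>x. sym_pos_def (A x)\<close> and \<delta> = \<open>0 < \<delta>\<close>
  have meas: "robust_loss l A \<delta> \<beta> lam \<in> borel_measurable P\<^sub>0" for \<beta> lam
    using borel_measurable_robust_loss[OF assms(7) spd assms(11)] by simp
  note moments = integrable_inner_moments[OF assms(4,5,13)]
  obtain g where g: "\<And>u. l 0 + g * u \<le> l u"
    using convex_on_real_affine_minorant[OF assms(11)] by blast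
  have not_MInf: "ereal_expectation P\<^sub>0 (robust_loss l A \<delta> \<beta> lam) \<noteq> - \<infinity>" if "0 \<le> lam" for \<beta> lam
  proof (rule ereal_expectation_lower_bound(2)[OF meas])
    show "integrable P\<^sub>0 (\<lambda>x. l 0 + g * (\<beta> \<bullet> x) + lam * sqrt \<delta>)"
      using moments by auto
    have "ereal (l 0 + g * (\<beta> \<bullet> x) + lam * sqrt \<delta>) \<le> robust_loss l A \<delta> \<beta> lam x" for x
      unfolding robust_loss_def
      using g[of "\<beta> \<bullet> x"] by (intro SUP_upper2[of 0]) (auto simp: dual_objective_def)
    then show "AE x in P\<^sub>0. ereal (l 0 + g * (\<beta> \<bullet> x) + lam * sqrt \<delta>) \<le> robust_loss l A \<delta> \<beta> lam x"
      by simp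
  qed
  have finite: "\<exists>lam\<ge>0. ereal_expectation P\<^sub>0 (robust_loss l A \<delta> \<beta> lam) < \<infinity>" for \<beta>
  proof -
    obtain s C where s: "0 \<le> s" "\<And>u. l u \<le> C + s * u\<^sup>2"
      using growth_constant_quadratic_bound[OF assms(12)] by blast
    \<comment> \<open>Replacing the inverse form by its bound
      \<open>(norm \<beta>)\<^sup>2 / \<rho>\<^sub>m\<^sub>i\<^sub>n\<close> gives one
      \<open>lam\<close> that meets the threshold of \<open>robust_loss_upper_bound\<close> for
      almost every \<open>x\<close>.\<close>
    define lam where "lam = 2 * s * sqrt \<delta> * ((norm \<beta>)\<^sup>2 / \<rho>\<^sub>m\<^sub>i\<^sub>n)"
    have lam: "0 \<le> lam"
      using s \<delta> \<open>0 < \<rho>\<^sub>m\<^sub>i\<^sub>n\<close> by (simp add: lam_def)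
    have int: "integrable P\<^sub>0 (\<lambda>x. C + 2 * s * (\<beta> \<bullet> x)\<^sup>2 + lam * sqrt \<delta>)" (is "integrable _ ?h")
      using moments by auto
    have "AE x in P\<^sub>0. robust_loss l A \<delta> \<beta> lam x \<le> ereal (?h x)"
      using assms(10)
    proof eventually_elim
      case (elim x)
      have "\<beta> \<bullet> (matrix_inv (A x) *v \<beta>) \<le> (norm \<beta>)\<^sup>2 / \<rho>\<^sub>m\<^sub>i\<^sub>n"
        using elim by (intro matrix_inv_form_le spd \<open>0 < \<rho>\<^sub>m\<^sub>i\<^sub>n\<close>) auto
      then show ?case
        unfolding lam_def using s \<delta>
        by (intro robust_loss_upper_bound spd \<delta> s mult_left_mono) auto
    qed
    then have "ereal_expectation P\<^sub>0 (robust_loss l A \<delta> \<beta> lam) \<le> ereal_expectation P\<^sub>0 (\<lambda>x. ereal (?h x))"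
      using int by (intro ereal_expectation_mono ereal_expectation_lower_bound(1)[OF _ int]) auto
    also have "\<dots> = ereal (integral\<^sup>L P\<^sub>0 ?h)"
      using int by (intro ereal_expectation_eq_integral) auto
    finally show ?thesis
      using lam by (intro exI[of _ lam]) auto
  qed
  have "proper_on (B \<times> {0..}) (robust_objective P\<^sub>0 l A \<delta>)"
    using not_MInf finite \<open>B \<noteq> {}\<close> unfolding proper_on_def robust_objective_def by fastforce
  moreover have "ereal_convex_on (B \<times> {0..}) (robust_objective P\<^sub>0 l A \<delta>)"
    unfolding ereal_convex_on_def
  proof (intro conjI ballI allI impI)
    show "convex (B \<times> {0::real..})"
      using \<open>convex B\<close> by (intro convex_Times) auto
    fix p q :: "(real^'d) \<times> real" and u v
    assume pq: "p \<in> B \<times> {0..}" "q \<in> B \<times> {0..}" and uv: "0 \<le> u" "0 \<le> v" "u + v = (1::real)"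
    obtain \<beta>\<^sub>1 lam\<^sub>1 \<beta>\<^sub>2 lam\<^sub>2 where eq: "p = (\<beta>\<^sub>1, lam\<^sub>1)" "q = (\<beta>\<^sub>2, lam\<^sub>2)"
      by (cases p; cases q)
    have lam: "0 \<le> lam\<^sub>1" "0 \<le> lam\<^sub>2"
      using pq eq by auto
    \<comment> \<open>Degenerate weights are split off because
      \<open>ereal_expectation_convex_combination\<close> needs positive ones; there zero times
      infinity is zero and both sides agree.\<close>
    consider "u = 0" "v = 1" | "u = 1" "v = 0" | "0 < u" "0 < v"
      using uv by linarith
    then show "robust_objective P\<^sub>0 l A \<delta> (u *\<^sub>R p + v *\<^sub>R q)
        \<le> ereal u * robust_objective P\<^sub>0 l A \<delta> p + ereal v * robust_objective P\<^sub>0 l A \<delta> q"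
    proof cases
      case 3
      then show ?thesis
        using robust_loss_convex[OF spd \<delta> assms(11) lam uv]
        by (auto simp: robust_objective_def eq intro!: ereal_expectation_convex_combination not_MInf lam)
    qed (simp_all flip: zero_ereal_def one_ereal_def)
  qed
  ultimately show ?thesis
    by blast
qed

end
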